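(* There exists an absolute constant $C>0$ such that the following holds. Let $(G,\cdot)$ be a group and let $A\subseteq G$ be a finite subset with $|A|>2$. If $|A\cdot A|\le K|A|$ for some positive integer $K$, then $\dim A\le C\cdot K\cdot \log|A|\cdot\log\log|A|$.
   Context: All logarithms are natural. $A\cdot A=\{a_1a_2: a_1,a_2\in A\}$. For a group $G$ with identity $e$, a subset $S\subseteq G$ is dissociated if there is no solution to $g_1^{\varepsilon_1}\cdots g_m^{\varepsilon_m}=e$ with $m\ge 1$, distinct $g_1,\dots,g_m\in S$ and $\varepsilon_1,\dots,\varepsilon_m\in\{-1,1\}$. For a finite subset $A\subseteq G$, the additive dimension $\dim A$ is the maximum cardinality of a dissociated subset of $A$. *)

theory Defs
  imports Complex_Main "HOL-Algebra.Coset"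
begin

(* The product g_1^e_1 ... g_m^e_m is taken in the order of the list, so in a noncommutative
   group every ordering of the chosen distinct elements is allowed as a possible relation. *)
definition dissociated :: "('a, 'b) monoid_scheme \<Rightarrow> 'a set \<Rightarrow> bool" where
  "dissociated G S \<longleftrightarrow> S \<subseteq> carrier G \<and>
     \<not> (\<exists>(gs :: 'a list) (es :: int list).
          length gs \<ge> 1 \<and> length es = length gs \<and> distinct gs \<and>
          set gs \<subseteq> S \<and> set es \<subseteq> {-1, 1} \<and>
          foldr (\<otimes>\<^bsub>G\<^esub>) (map2 (\<lambda>g e. g [^]\<^bsub>G\<^esub> e) gs es) \<one>\<^bsub>G\<^esub> = \<one>\<^bsub>G\<^esub>)"

(* Only meaningful for finite A; the set of cardinalities contains 0 (the empty set is
   dissociated) and is bounded by card A, so the maximum exists. *)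
definition add_dim :: "('a, 'b) monoid_scheme \<Rightarrow> 'a set \<Rightarrow> nat" where
  "add_dim G A = Max (card ` {S. S \<subseteq> A \<and> dissociated G S})"

definition dim_bound :: "real \<Rightarrow> ('a, 'b) monoid_scheme \<Rightarrow> bool" where
  "dim_bound C G \<longleftrightarrow>
     (\<forall>(A :: 'a set) (K :: nat).
        A \<subseteq> carrier G \<and> finite A \<and> card A > 2 \<and> K > 0 \<and>
        card (A <#>\<^bsub>G\<^esub> A) \<le> K * card A \<longrightarrow>
        real (add_dim G A) \<le> C * real K * ln (real (card A)) * ln (ln (real (card A))))"

(* HOL cannot quantify over types inside a formula, so "there is C > 0 such that for all groups G
   dim_bound C G" would, with the groups on a type variable 'a, allow C to depend on 'a. To make
   the constant absolute, use the two assertions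
     (1) some C > 0 satisfies dim_bound C G for all groups G with elements of type nat;
     (2) every C > 0 as in (1) satisfies dim_bound C G for all groups G with elements of type 'a.
   Since (1) does not mention 'a, together they give one C valid for groups on every type. *)

end

theory Submission
  imports Defs "HOL-Algebra.Generated_Groups" "HOL-Library.Countable_Set"
begin

text \<open>
  Join \<open>x\<close> and \<open>x \<otimes> c\<close> by an edge of colour \<open>c\<close>, for \<open>c\<close> in a dissociated set \<open>S \<subseteq> A\<close>. On
  \<open>A \<union> A\<cdot>A\<close>, which has at most \<open>(K + 1) |A|\<close> points, there are at least \<open>|S| |A|\<close> edges, and a
  closed walk with distinct colours would be a forbidden relation. Among the subsets choose an
  \<open>H\<close> of maximal density \<open>e(H) / (|H| ln |H|)\<close>; entropy then gives every \<open>U \<subseteq> H\<close> at least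
  \<open>\<rho> |U| ln (|H| / |U|)\<close> boundary edges. Fix \<open>v \<in> H\<close> and let \<open>U\<^sub>Q\<close> be the set of points reached from
  \<open>v\<close> by walks in \<open>H\<close> with distinct colours from \<open>Q\<close>. An edge of colour \<open>c\<close> leaving \<open>U\<^sub>Q\<close> makes
  \<open>c\<close> pivotal, both for \<open>c \<notin> Q\<close> (adding \<open>c\<close> reaches the new endpoint) and for \<open>c \<in> Q\<close> (without
  \<open>c\<close> the old endpoint is lost). Hence for \<open>q\<close>-random \<open>Q\<close> the Margulis--Russo formula shows that
  \<open>\<psi>(q) = E ln (|H| / |U\<^sub>Q|)\<close> satisfies \<open>\<psi>' \<le> - (\<rho> / 4) \<psi>\<close>. If \<open>\<rho>\<close> exceeds a constant times
  \<open>ln ln |H|\<close>, then at \<open>q = 1/2\<close> some \<open>Q\<close> and its complement both reach more than about half of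
  \<open>H\<close>, so they reach a common point other than \<open>v\<close>, which is a relation in \<open>S\<close>.
\<close>

section \<open>Averages over random subsets\<close>

text \<open>The mean of \<open>f Q\<close> when \<open>Q\<close> contains each element of
  \<open>S\<close> independently with probability \<open>q\<close>. The formula is a polynomial in
  \<open>q\<close>, so it can be differentiated at \<open>0\<close> as well.\<close>

definition subset_avg :: "real \<Rightarrow> 'c set \<Rightarrow> ('c set \<Rightarrow> real) \<Rightarrow> real" where
  "subset_avg q S f = (\<Sum>Q\<in>Pow S. q ^ card Q * (1 - q) ^ card (S - Q) * f Q)"

lemma subset_avg_empty [simp]: "subset_avg q {} f = f {}"
  by (simp add: subset_avg_def)

text \<open>Conditioning on whether \<open>x\<close> is chosen; the inductions over \<open>S\<close>
  run through this recursion.\<close>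

lemma subset_avg_insert:
  assumes "finite S" "x \<notin> S"
  shows "subset_avg q (insert x S) f
    = q * subset_avg q S (\<lambda>Q. f (insert x Q)) + (1 - q) * subset_avg q S f"
proof -
  let ?w = "\<lambda>T Q. q ^ card Q * (1 - q) ^ card (T - Q) * f Q"
  have inj: "inj_on (insert x) (Pow S)"
    using assms(2) by (auto simp: inj_on_def)
  have A: "?w (insert x S) Q = (1 - q) * ?w S Q" if "Q \<in> Pow S" for Q
  proof -
    have "insert x S - Q = insert x (S - Q)" using that assms by auto
    then show ?thesis using assms by simp
  qed
  have B: "?w (insert x S) (insert x Q) = q * (q ^ card Q * (1 - q) ^ card (S - Q) * f (insert x Q))"
    if "Q \<in> Pow S" for Q
  proof -
    have "finite Q" "x \<notin> Q" using that assms by (auto intro: finite_subset)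
    moreover have "insert x S - insert x Q = S - Q" using assms by auto
    ultimately show ?thesis by simp
  qed
  have "subset_avg q (insert x S) f
      = (\<Sum>Q\<in>Pow S. ?w (insert x S) Q) + (\<Sum>Q\<in>insert x ` Pow S. ?w (insert x S) Q)"
    unfolding subset_avg_def Pow_insert
    by (rule sum.union_disjoint) (use assms in auto)
  also have "(\<Sum>Q\<in>insert x ` Pow S. ?w (insert x S) Q) = (\<Sum>Q\<in>Pow S. ?w (insert x S) (insert x Q))"
    by (simp add: sum.reindex[OF inj])
  also have "\<dots> = q * subset_avg q S (\<lambda>Q. f (insert x Q))"
    unfolding subset_avg_def sum_distrib_left by (rule sum.cong[OF refl B])
  also have "(\<Sum>Q\<in>Pow S. ?w (insert x S) Q) = (1 - q) * subset_avg q S f"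
    unfolding subset_avg_def sum_distrib_left by (rule sum.cong[OF refl A])
  finally show ?thesis by simp
qed

lemma subset_avg_const: "finite S \<Longrightarrow> subset_avg q S (\<lambda>_. k) = k"
  by (induction S rule: finite_induct) (simp_all add: subset_avg_insert algebra_simps)

lemma subset_avg_at_0: "finite S \<Longrightarrow> subset_avg 0 S f = f {}"
  by (induction S rule: finite_induct) (simp_all add: subset_avg_insert)

lemma subset_avg_cong: "(\<And>Q. Q \<subseteq> S \<Longrightarrow> f Q = g Q) \<Longrightarrow> subset_avg q S f = subset_avg q S g"
  unfolding subset_avg_def by (rule sum.cong) auto

lemma subset_avg_diff: "subset_avg q S (\<lambda>Q. f Q - g Q) = subset_avg q S f - subset_avg q S g"
  by (simp add: subset_avg_def sum_subtractf algebra_simps)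

lemma subset_avg_cmult: "subset_avg q S (\<lambda>Q. k * f Q) = k * subset_avg q S f"
  by (simp add: subset_avg_def sum_distrib_left algebra_simps)

lemma subset_avg_sum:
  "subset_avg q S (\<lambda>Q. \<Sum>c\<in>T. f c Q) = (\<Sum>c\<in>T. subset_avg q S (f c))"
  unfolding subset_avg_def sum_distrib_left by (rule sum.swap)

lemma subset_avg_mono:
  assumes "0 \<le> q" "q \<le> 1" "\<And>Q. Q \<subseteq> S \<Longrightarrow> f Q \<le> g Q"
  shows "subset_avg q S f \<le> subset_avg q S g"
  unfolding subset_avg_def by (rule sum_mono) (use assms in \<open>auto intro!: mult_left_mono\<close>)

text \<open>The Margulis--Russo formula.\<close>

lemma subset_avg_has_derivative:
  assumes "finite S"
  shows "((\<lambda>q. subset_avg q S f) has_real_derivative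
    subset_avg q S (\<lambda>Q. \<Sum>c\<in>S. f (insert c Q) - f (Q - {c}))) (at q)"
  using assms
proof (induction S arbitrary: f rule: finite_induct)
  case empty
  then show ?case by simp
next
  case (insert x S)
  let ?g = "\<lambda>Q. f (insert x Q)"
  let ?D = "\<lambda>h c Q. h (insert c Q) - h (Q - {c}) :: real"
  \<comment> \<open>Neither \<open>f (insert x Q)\<close> nor \<open>f (Q - {x})\<close> depends on
    whether \<open>x\<close> lies in \<open>Q\<close>. This is the term that the product rule takes
    from the coefficients \<open>q\<close> and \<open>1 - q\<close>.\<close>
  have 1: "subset_avg q (insert x S) (?D f x) = subset_avg q S ?g - subset_avg q S f"
  proof -
    have "subset_avg q S (\<lambda>Q. ?D f x (insert x Q)) = subset_avg q S (\<lambda>Q. ?g Q - f Q)"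
      by (rule subset_avg_cong, subst Diff_insert_absorb) (use insert.hyps in auto)
    moreover have "subset_avg q S (?D f x) = subset_avg q S (\<lambda>Q. ?g Q - f Q)"
      by (rule subset_avg_cong, subst Diff_triv) (use insert.hyps in auto)
    ultimately show ?thesis
      by (simp add: subset_avg_insert insert.hyps subset_avg_diff algebra_simps)
  qed
  have 2: "subset_avg q (insert x S) (?D f c)
      = q * subset_avg q S (?D ?g c) + (1 - q) * subset_avg q S (?D f c)" if "c \<in> S" for c
  proof -
    have "insert x Q - {c} = insert x (Q - {c})" for Q using that insert.hyps by auto
    then have "subset_avg q S (\<lambda>Q. ?D f c (insert x Q)) = subset_avg q S (?D ?g c)"
      by (simp add: insert_commute)
    then show ?thesis by (simp add: subset_avg_insert insert.hyps)
  qed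
  have "subset_avg q (insert x S) (\<lambda>Q. \<Sum>c\<in>insert x S. ?D f c Q)
      = subset_avg q S ?g - subset_avg q S f
        + (q * subset_avg q S (\<lambda>Q. \<Sum>c\<in>S. ?D ?g c Q) + (1 - q) * subset_avg q S (\<lambda>Q. \<Sum>c\<in>S. ?D f c Q))"
    unfolding subset_avg_sum
    using insert.hyps by (simp add: 1 2 sum.distrib sum_distrib_left)
  moreover have "((\<lambda>q. subset_avg q (insert x S) f) has_real_derivative \<dots>) (at q)"
    unfolding subset_avg_insert[OF insert.hyps]
    by (rule derivative_eq_intros insert.IH refl | simp)+
  ultimately show ?case by simp
qed

text \<open>Gronwall's argument: by the Margulis-Russo formula, \<open>grow\<close> makes
  \<open>exp (lam * q) * (M - subset_avg q S f)\<close> non-increasing on [0, 1/2], and at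
  \<open>q = 0\<close> the random set is empty.\<close>

lemma subset_avg_gronwall:
  fixes f :: "'c set \<Rightarrow> real"
  assumes fin: "finite S"
    and grow: "\<And>Q. Q \<subseteq> S \<Longrightarrow> lam * (M - f Q) \<le> (\<Sum>c\<in>S. f (insert c Q) - f (Q - {c}))"
  shows "M - subset_avg (1/2) S f \<le> exp (- lam / 2) * (M - f {})"
proof -
  let ?F = "\<lambda>q. subset_avg q S f"
  let ?F' = "\<lambda>q. subset_avg q S (\<lambda>Q. \<Sum>c\<in>S. f (insert c Q) - f (Q - {c}))"
  let ?h = "\<lambda>q. exp (lam * q) * (M - ?F q)"
  have "?h (1/2) \<le> ?h 0"
  proof (rule DERIV_nonpos_imp_nonincreasing[where f = ?h])
    fix q :: real assume q: "0 \<le> q" "q \<le> 1/2"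
    have "lam * (M - ?F q) = subset_avg q S (\<lambda>Q. lam * (M - f Q))"
      using fin by (simp add: subset_avg_cmult subset_avg_diff subset_avg_const)
    also have "\<dots> \<le> ?F' q"
      by (rule subset_avg_mono) (use q grow in auto)
    finally have "exp (lam * q) * (lam * (M - ?F q) - ?F' q) \<le> 0"
      by (simp add: mult_le_0_iff)
    moreover have "(?h has_real_derivative exp (lam * q) * (lam * (M - ?F q) - ?F' q)) (at q)"
      by (rule derivative_eq_intros subset_avg_has_derivative[OF fin] refl)+
        (simp add: right_diff_distrib)
    ultimately show "\<exists>y. (?h has_real_derivative y) (at q) \<and> y \<le> 0" by blast
  qed simp
  then have "exp (- lam / 2) * (exp (lam / 2) * (M - ?F (1/2))) \<le> exp (- lam / 2) * (M - f {})"
    by (simp add: subset_avg_at_0[OF fin])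
  then show ?thesis by (simp flip: mult.assoc exp_add)
qed

text \<open>For \<open>q = 1/2\<close> a set and its complement have the same distribution, so
  \<open>f Q + f (S - Q)\<close> has twice the mean of \<open>f\<close>, and some \<open>Q\<close>
  reaches that mean.\<close>

lemma complementary_subsets_exist:
  fixes f :: "'c set \<Rightarrow> real"
  assumes fin: "finite S"
    and grow: "\<And>Q. Q \<subseteq> S \<Longrightarrow> lam * (M - f Q) \<le> (\<Sum>c\<in>S. f (insert c Q) - f (Q - {c}))"
  shows "\<exists>Q\<subseteq>S. 2 * M - f Q - f (S - Q) \<le> 2 * exp (- lam / 2) * (M - f {})"
proof (rule ccontr)
  assume "\<not> ?thesis"
  then have *: "f Q + f (S - Q) < 2 * M - 2 * exp (- lam / 2) * (M - f {})" if "Q \<subseteq> S" for Q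
    using that by force
  have half: "subset_avg (1/2) S h = (\<Sum>Q\<in>Pow S. h Q) / 2 ^ card S" for h :: "'c set \<Rightarrow> real"
  proof -
    have "(1/2::real) ^ card Q * (1 - 1/2) ^ card (S - Q) = 1 / 2 ^ card S" if "Q \<in> Pow S" for Q
    proof -
      have "card Q + card (S - Q) = card S"
        using that fin by (simp add: card_Diff_subset card_mono finite_subset)
      then show ?thesis by (simp add: power_one_over flip: power_add)
    qed
    then show ?thesis by (simp add: subset_avg_def sum_divide_distrib)
  qed
  have "(\<Sum>Q\<in>Pow S. f (S - Q)) = (\<Sum>Q\<in>Pow S. f Q)"
    by (rule sum.reindex_bij_witness[of _ "\<lambda>Q. S - Q" "\<lambda>Q. S - Q"]) (auto simp: double_diff)
  then have "2 * subset_avg (1/2) S f = (\<Sum>Q\<in>Pow S. f Q + f (S - Q)) / 2 ^ card S"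
    by (simp add: half sum.distrib)
  also have "\<dots> < (\<Sum>Q\<in>Pow S. 2 * M - 2 * exp (- lam / 2) * (M - f {})) / 2 ^ card S"
    by (intro divide_strict_right_mono sum_strict_mono) (use fin * in auto)
  also have "\<dots> = 2 * M - 2 * exp (- lam / 2) * (M - f {})"
    using fin by (simp add: card_Pow)
  finally show False
    using subset_avg_gronwall[OF fin grow] by simp
qed

section \<open>Expanding subsets\<close>

text \<open>Let \<open>H\<close> maximise the density \<open>r\<close>, and let h = u + w be the
  sizes of \<open>H\<close>, \<open>U\<close> and \<open>H - U\<close>. Maximality bounds
  \<open>e U\<close> and \<open>e (H - U)\<close>, so the right side is at least \<open>r H\<close>
  times h ln h - u ln u - w ln w. This is at least u (ln h - ln u), because w ln w \<le> w ln h;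
  finally \<open>r V\<close> \<le> \<open>r H\<close>.\<close>

lemma entropy_expander:
  fixes e :: "'a set \<Rightarrow> real"
  assumes fin: "finite V" and V: "2 \<le> card V" and e_V: "0 \<le> e V"
    and e_small: "\<And>U. U \<subseteq> V \<Longrightarrow> card U \<le> 1 \<Longrightarrow> e U = 0"
  obtains H where "H \<subseteq> V" "2 \<le> card H"
    "\<And>U. U \<subseteq> H \<Longrightarrow> U \<noteq> {} \<Longrightarrow>
      e V / (card V * ln (card V)) * (card U * (ln (card H) - ln (card U))) \<le> e H - e U - e (H - U)"
proof -
  define r where "r U = e U / (card U * ln (card U))" for U :: "'a set"
  let ?X = "{U. U \<subseteq> V \<and> 2 \<le> card U}"
  have finX: "finite ?X" using fin by simp
  have neX: "?X \<noteq> {}" using V by auto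
  have "Max (r ` ?X) \<in> r ` ?X"
    using finX neX by (intro Max_in) auto
  then obtain H where rH: "r H = Max (r ` ?X)" and HX: "H \<in> ?X"
    by (elim imageE) (rule that, simp_all only:)
  have H: "H \<subseteq> V" "2 \<le> card H" using HX by auto
  have max: "r U \<le> r H" if "U \<subseteq> V" "2 \<le> card U" for U
    unfolding rH using finX that by (intro Max_ge) auto
  have eH: "e H = r H * (card H * ln (card H))"
    using H by (simp add: r_def)
  \<comment> \<open>The bound extends to sets outside \<open>?X\<close>: with at most one point both
    sides vanish.\<close>
  have eU: "e U \<le> r H * (card U * ln (card U))" if "U \<subseteq> V" for U
  proof (cases "card U \<le> 1")
    case True
    then have "card U = 0 \<or> card U = 1" by linarith
    then show ?thesis using e_small[OF that True] by auto
  next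
    case False
    then have "0 < card U * ln (card U)" by simp
    then show ?thesis using max[OF that] False by (simp add: r_def pos_divide_le_eq)
  qed
  have rV: "0 \<le> r V" using e_V V by (simp add: r_def)
  have "r V * (card U * (ln (card H) - ln (card U))) \<le> e H - e U - e (H - U)"
    if U: "U \<subseteq> H" "U \<noteq> {}" for U
  proof -
    let ?W = "H - U"
    have finH: "finite H" using H fin finite_subset by blast
    have finU: "finite U" using U finH finite_subset by blast
    have u: "0 < card U" using finU U by (simp add: card_gt_0_iff)
    have le: "card U \<le> card H" using U finH by (simp add: card_mono)
    have sum: "real (card H) = card U + card ?W"
      using finU U le by (simp add: card_Diff_subset)
    have lnU: "0 \<le> card U * (ln (card H) - ln (card U))" using u le by simp
    have "card ?W * ln (card ?W) \<le> card ?W * ln (card H)"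
    proof (cases "card ?W = 0")
      case False
      moreover have "card ?W \<le> card H" using finH by (intro card_mono) auto
      ultimately show ?thesis by (intro mult_left_mono) auto
    qed simp
    moreover have "card H * ln (card H) = card U * ln (card H) + card ?W * ln (card H)"
      by (simp only: sum of_nat_add distrib_right)
    ultimately have "card U * (ln (card H) - ln (card U))
        \<le> card H * ln (card H) - card U * ln (card U) - card ?W * ln (card ?W)"
      by (simp add: right_diff_distrib)
    then have "r H * (card U * (ln (card H) - ln (card U)))
        \<le> r H * (card H * ln (card H) - card U * ln (card U) - card ?W * ln (card ?W))"
      using rV max[of V] V by (intro mult_left_mono) auto
    also have "\<dots> = e H - r H * (card U * ln (card U)) - r H * (card ?W * ln (card ?W))"
      by (simp add: eH right_diff_distrib)
    also have "\<dots> \<le> e H - e U - e ?W"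
      using eU[of U] eU[of ?W] U H by (smt (verit) Diff_subset subset_trans)
    finally show ?thesis
      using mult_right_mono[OF max[of V] lnU] V by simp
  qed
  with H that show ?thesis unfolding r_def by blast
qed

section \<open>Signed words and rainbow walks\<close>

definition signed_word :: "('a, 'b) monoid_scheme \<Rightarrow> 'a list \<Rightarrow> int list \<Rightarrow> 'a" where
  "signed_word G gs es = foldr (\<otimes>\<^bsub>G\<^esub>) (map2 (\<lambda>g e. g [^]\<^bsub>G\<^esub> e) gs es) \<one>\<^bsub>G\<^esub>"

lemma signed_word_simps [simp]:
  "signed_word G [] es = \<one>\<^bsub>G\<^esub>" "signed_word G gs [] = \<one>\<^bsub>G\<^esub>"
  "signed_word G (g # gs) (e # es) = g [^]\<^bsub>G\<^esub> e \<otimes>\<^bsub>G\<^esub> signed_word G gs es"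
  by (simp_all add: signed_word_def)

lemma dissociated_iff_signed_word:
  "dissociated G S \<longleftrightarrow> S \<subseteq> carrier G \<and>
    (\<forall>gs es. length es = length gs \<and> distinct gs \<and> set gs \<subseteq> S \<and> set es \<subseteq> {-1, 1} \<and>
      signed_word G gs es = \<one>\<^bsub>G\<^esub> \<longrightarrow> gs = [])"
  unfolding dissociated_def signed_word_def[symmetric] One_nat_def Suc_le_eq length_greater_0_conv
  by blast

lemma (in group) signed_word_closed:
  "set gs \<subseteq> carrier G \<Longrightarrow> signed_word G gs es \<in> carrier G"
proof (induction gs arbitrary: es)
  case (Cons g gs)
  then show ?case by (cases es) auto
qed simp

lemma (in group) signed_word_append:
  assumes "length es = length gs" "set gs \<subseteq> carrier G" "set gs' \<subseteq> carrier G"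
  shows "signed_word G (gs @ gs') (es @ es') = signed_word G gs es \<otimes> signed_word G gs' es'"
  using assms
proof (induction es gs rule: list_induct2)
  case (Cons e es g gs)
  then show ?case by (simp add: m_assoc signed_word_closed)
qed (simp add: signed_word_closed)

text \<open>Serves to glue two words of equal value into one word of value
  \<open>\<one>\<close>.\<close>

lemma (in group) signed_word_rev:
  assumes "length es = length gs" "set gs \<subseteq> carrier G"
  shows "signed_word G (rev gs) (map uminus (rev es)) = inv (signed_word G gs es)"
  using assms
proof (induction es gs rule: list_induct2)
  case (Cons e es g gs)
  then show ?case
    by (simp add: signed_word_append signed_word_closed inv_mult_group int_pow_neg)
qed simp

lemma (in group_hom) hom_signed_word:
  "set gs \<subseteq> carrier G \<Longrightarrow> h (signed_word G gs es) = signed_word H (map h gs) es"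
proof (induction gs arbitrary: es)
  case (Cons g gs)
  then show ?case by (cases es) (auto simp: G.signed_word_closed hom_int_pow)
qed simp

text \<open>The disjunction in \<open>step\<close> lets an edge be crossed in either direction,
  matching the exponents 1 and -1. The condition \<open>c \<notin> P\<close> supplies the
  distinctness that dissociation speaks of.\<close>

inductive rainbow_walk :: "('a, 'b) monoid_scheme \<Rightarrow> 'a set \<Rightarrow> 'a \<Rightarrow> 'a set \<Rightarrow> 'a \<Rightarrow> bool"
  for G (structure) and H v where
  start: "rainbow_walk G H v {} v"
| step: "rainbow_walk G H v P x \<Longrightarrow> c \<in> carrier G \<Longrightarrow> c \<notin> P \<Longrightarrow> y \<in> H \<Longrightarrow>
    y = x \<otimes> c \<or> x = y \<otimes> c \<Longrightarrow> rainbow_walk G H v (insert c P) y"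

text \<open>The set argument of a walk is the set of colours it has used.\<close>

definition reachable :: "('a, 'b) monoid_scheme \<Rightarrow> 'a set \<Rightarrow> 'a \<Rightarrow> 'a set \<Rightarrow> 'a set" where
  "reachable G H v Q = {x. \<exists>P\<subseteq>Q. rainbow_walk G H v P x}"

lemma (in group) rainbow_walk_signed_word:
  assumes "rainbow_walk G H v P x" "H \<subseteq> carrier G" "v \<in> H"
  shows "x \<in> H \<and> P \<subseteq> carrier G \<and> (\<exists>gs es. distinct gs \<and> set gs = P \<and> length es = length gs \<and>
    set es \<subseteq> {-1, 1} \<and> x = v \<otimes> signed_word G gs es)"
  using assms
proof (induction rule: rainbow_walk.induct)
  case start
  then show ?case by auto
next
  case (step P x c y)
  then obtain gs es where w: "distinct gs" "set gs = P" "length es = length gs" "set es \<subseteq> {-1, 1}"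
      "x = v \<otimes> signed_word G gs es" and P: "P \<subseteq> carrier G" and x: "x \<in> carrier G"
    by blast
  have v: "v \<in> carrier G" and y: "y \<in> carrier G" using step.prems step.hyps by auto
  \<comment> \<open>The exponent records the direction in which the last edge is crossed.\<close>
  obtain e :: int where e: "e \<in> {-1, 1}" "y = x \<otimes> c [^] e"
  proof (cases "y = x \<otimes> c")
    case True
    then show ?thesis using that[of 1] step.hyps by simp
  next
    case False
    then have "y = x \<otimes> inv c" using step.hyps y by (simp add: m_assoc)
    then show ?thesis using that[of "-1"] step.hyps by (simp add: int_pow_neg)
  qed
  have "y = v \<otimes> signed_word G (gs @ [c]) (es @ [e])"
    using w P v e step.hyps
    by (simp add: signed_word_append signed_word_closed m_assoc)
  then have "distinct (gs @ [c]) \<and> set (gs @ [c]) = insert c P \<and> length (es @ [e]) = length (gs @ [c])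
      \<and> set (es @ [e]) \<subseteq> {-1, 1} \<and> y = v \<otimes> signed_word G (gs @ [c]) (es @ [e])"
    using w e step.hyps by auto
  then show ?case using step.hyps P by blast
qed

lemma start_reachable: "v \<in> reachable G H v Q"
  by (auto simp: reachable_def intro: rainbow_walk.start)

lemma reachable_mono: "Q \<subseteq> R \<Longrightarrow> reachable G H v Q \<subseteq> reachable G H v R"
  by (auto simp: reachable_def)

text \<open>Reaching \<open>x\<close> without \<open>c\<close> leaves \<open>c\<close> free for one
  more step. Writing \<open>Q - {c}\<close> and \<open>insert c Q\<close> covers both
  \<open>c \<in> Q\<close> and \<open>c \<notin> Q\<close>.\<close>

lemma reachable_step:
  assumes "x \<in> reachable G H v (Q - {c})" "c \<in> carrier G" "y \<in> H"
    "y = x \<otimes>\<^bsub>G\<^esub> c \<or> x = y \<otimes>\<^bsub>G\<^esub> c"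
  shows "y \<in> reachable G H v (insert c Q)"
proof -
  obtain P where "P \<subseteq> Q - {c}" "rainbow_walk G H v P x"
    using assms by (auto simp: reachable_def)
  then have "insert c P \<subseteq> insert c Q" "rainbow_walk G H v (insert c P) y"
    using assms by (auto intro: rainbow_walk.step)
  then show ?thesis unfolding reachable_def by blast
qed

lemma (in group) reachable_subset:
  "H \<subseteq> carrier G \<Longrightarrow> v \<in> H \<Longrightarrow> reachable G H v Q \<subseteq> H"
  by (auto simp: reachable_def dest: rainbow_walk_signed_word)

lemma (in group) reachable_signed_word:
  assumes "x \<in> reachable G H v Q" "H \<subseteq> carrier G" "v \<in> H"
  shows "\<exists>gs es. distinct gs \<and> set gs \<subseteq> Q \<and> length es = length gs \<and> set es \<subseteq> {-1, 1} \<and>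
    x = v \<otimes> signed_word G gs es \<and> set gs \<subseteq> carrier G"
proof -
  obtain P where P: "P \<subseteq> Q" "rainbow_walk G H v P x"
    using assms(1) unfolding reachable_def by blast
  then show ?thesis
    using rainbow_walk_signed_word[OF P(2) assms(2,3)] by blast
qed

text \<open>Two walks from \<open>v\<close> to \<open>x\<close> give words w, w' of equal value.
  Their colours come from disjoint sets, so w times the inverse of w' has distinct letters and must
  be empty.\<close>

lemma (in group) reachable_Int_dissociated:
  assumes diss: "dissociated G S" and H: "H \<subseteq> carrier G" "v \<in> H"
    and QR: "Q \<subseteq> S" "R \<subseteq> S" "Q \<inter> R = {}"
  shows "reachable G H v Q \<inter> reachable G H v R = {v}"
proof -
  have "x = v" if xQ: "x \<in> reachable G H v Q" and xR: "x \<in> reachable G H v R" for x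
  proof -
    obtain gs es where 1: "distinct gs" "set gs \<subseteq> Q" "length es = length gs" "set es \<subseteq> {-1, 1}"
        "x = v \<otimes> signed_word G gs es" "set gs \<subseteq> carrier G"
      using reachable_signed_word[OF xQ H] by metis
    obtain gs' es' where 2: "distinct gs'" "set gs' \<subseteq> R" "length es' = length gs'"
        "set es' \<subseteq> {-1, 1}" "x = v \<otimes> signed_word G gs' es'" "set gs' \<subseteq> carrier G"
      using reachable_signed_word[OF xR H] by metis
    let ?gs = "gs @ rev gs'" and ?es = "es @ map uminus (rev es')"
    have v: "v \<in> carrier G" using H by auto
    have "signed_word G gs es = signed_word G gs' es'"
      using 1(5) 2(5) v Units_l_cancel[of v] signed_word_closed[OF 1(6)] signed_word_closed[OF 2(6)]
      by simp
    then have "signed_word G ?gs ?es = \<one>"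
      using 1 2 by (simp add: signed_word_append signed_word_rev signed_word_closed)
    moreover have "distinct ?gs" "set ?gs \<subseteq> S" "length ?es = length ?gs" "set ?es \<subseteq> {-1, 1}"
      using 1 2 QR by auto
    ultimately have "?gs = []"
      using diss unfolding dissociated_iff_signed_word by blast
    then show ?thesis using 1 v by simp
  qed
  then show ?thesis using start_reachable by fastforce
qed

lemma (in group) one_notin_dissociated:
  assumes "dissociated G S"
  shows "\<one> \<notin> S"
proof
  assume "\<one> \<in> S"
  then have "length [1::int] = length [\<one>] \<and> distinct [\<one>] \<and> set [\<one>] \<subseteq> S \<and> set [1::int] \<subseteq> {-1, 1} \<and>
      signed_word G [\<one>] [1] = \<one>"
    by simp
  then show False
    using assms unfolding dissociated_iff_signed_word by blast
qed

section \<open>Growth of the reachable set\<close>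

text \<open>Edges of the Cayley graph of \<open>S\<close> induced on \<open>U\<close>, each counted
  at its tail \<open>x\<close>; a colour of order two thus counts each of its pairs twice.\<close>

definition edge_count :: "('a, 'b) monoid_scheme \<Rightarrow> 'a set \<Rightarrow> 'a set \<Rightarrow> nat" where
  "edge_count G S U = (\<Sum>c\<in>S. card {x\<in>U. x \<otimes>\<^bsub>G\<^esub> c \<in> U})"

lemma edge_count_boundary:
  assumes "finite H" "U \<subseteq> H"
  shows "real (edge_count G S H) - edge_count G S U - edge_count G S (H - U)
    = (\<Sum>c\<in>S. real (card {x\<in>U. x \<otimes>\<^bsub>G\<^esub> c \<in> H - U}) + card {x\<in>H - U. x \<otimes>\<^bsub>G\<^esub> c \<in> U})"
proof -
  have "card {x\<in>H. x \<otimes>\<^bsub>G\<^esub> c \<in> H} = card {x\<in>U. x \<otimes>\<^bsub>G\<^esub> c \<in> U} + card {x\<in>H - U. x \<otimes>\<^bsub>G\<^esub> c \<in> H - U}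
      + (card {x\<in>U. x \<otimes>\<^bsub>G\<^esub> c \<in> H - U} + card {x\<in>H - U. x \<otimes>\<^bsub>G\<^esub> c \<in> U})" for c
  proof -
    let ?A = "{x\<in>U. x \<otimes>\<^bsub>G\<^esub> c \<in> U}" and ?B = "{x\<in>H - U. x \<otimes>\<^bsub>G\<^esub> c \<in> H - U}"
      and ?C = "{x\<in>U. x \<otimes>\<^bsub>G\<^esub> c \<in> H - U}" and ?D = "{x\<in>H - U. x \<otimes>\<^bsub>G\<^esub> c \<in> U}"
    have "finite U" using assms finite_subset by blast
    then have fin: "finite ?A" "finite ?B" "finite ?C" "finite ?D" using assms(1) by simp_all
    have "{x\<in>H. x \<otimes>\<^bsub>G\<^esub> c \<in> H} = (?A \<union> ?B) \<union> (?C \<union> ?D)" using assms by auto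
    moreover have "card ((?A \<union> ?B) \<union> (?C \<union> ?D)) = card (?A \<union> ?B) + card (?C \<union> ?D)"
      by (rule card_Un_disjoint) (use fin in \<open>blast+\<close>)
    moreover have "card (?A \<union> ?B) = card ?A + card ?B"
      by (rule card_Un_disjoint) (use fin in \<open>blast+\<close>)
    moreover have "card (?C \<union> ?D) = card ?C + card ?D"
      by (rule card_Un_disjoint) (use fin in \<open>blast+\<close>)
    ultimately show ?thesis by (simp only:)
  qed
  then show ?thesis by (simp add: edge_count_def sum.distrib)
qed

text \<open>Follows from ln z \<le> z - 1 at z = u / t; \<open>m \<le> u\<close> costs the factor 2.
  Here \<open>u\<close> and \<open>t\<close> stand for the old and new sizes of a reachable set and
  \<open>m\<close> for a lower bound on its gain.\<close>

lemma ln_ratio_ge: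
  fixes u t m :: real
  assumes "0 < u" "0 \<le> m" "m \<le> u" "u + m \<le> t"
  shows "m / (2 * u) \<le> ln t - ln u"
proof -
  have "m / (2 * u) \<le> m / (u + m)" using assms by (intro divide_left_mono) auto
  also have "\<dots> = 1 - u / (u + m)" using assms by (simp add: field_simps)
  also have "\<dots> \<le> 1 - u / t" using assms by (simp add: frac_le)
  also have "\<dots> \<le> ln t - ln u"
    using ln_le_minus_one[of "u / t"] assms by (simp add: ln_div)
  finally show ?thesis .
qed

text \<open>
  The denominator is \<open>4\<close> because \<open>c\<close> joins a point \<open>x\<close> to both \<open>x \<otimes> c\<close> and \<open>x \<otimes> inv c\<close>, so only the
  average of the two boundary counts bounds the number of points gained or lost.
\<close>

lemma (in group) ln_reachable_influence:
  assumes H: "finite H" "H \<subseteq> carrier G" "v \<in> H" and c: "c \<in> carrier G"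
  defines "U \<equiv> \<lambda>Q. reachable G H v Q"
  shows "(real (card {x\<in>U Q. x \<otimes> c \<in> H - U Q}) + card {x\<in>H - U Q. x \<otimes> c \<in> U Q}) / (4 * card (U Q))
    \<le> ln (card (U (insert c Q))) - ln (card (U (Q - {c})))"
    (is "(real (card ?D) + card ?D') / _ \<le> _")
proof -
  have sub: "U R \<subseteq> H" for R using reachable_subset H by (simp add: U_def)
  have fin: "finite (U R)" for R using sub H finite_subset by blast
  have pos: "0 < card (U R)" for R
    using fin[of R] start_reachable[of v G H R] by (auto simp: U_def card_gt_0_iff)
  have D: "card ?D \<le> card (U Q)" by (rule card_mono[OF fin]) auto
  have inj: "inj_on (\<lambda>x. x \<otimes> c) X" if "X \<subseteq> H" for X
    using inj_on_multc[OF c] that H by (meson inj_on_subset)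
  have img: "card ((\<lambda>x. x \<otimes> c) ` X) = card X" if "X \<subseteq> H" for X
    using inj[OF that] by (rule card_image)
  \<comment> \<open>\<open>?D'\<close> lies outside \<open>U Q\<close>, but multiplication by
    \<open>c\<close> injects it into \<open>U Q\<close>.\<close>
  have D': "card ?D' \<le> card (U Q)"
  proof -
    have "(\<lambda>x. x \<otimes> c) ` ?D' \<subseteq> U Q" by blast
    then have "card ((\<lambda>x. x \<otimes> c) ` ?D') \<le> card (U Q)" by (rule card_mono[OF fin])
    moreover have "?D' \<subseteq> H" by blast
    ultimately show ?thesis using img by simp
  qed
  have finD: "finite ?D" "finite ?D'" using fin H by auto
  let ?m = "(real (card ?D) + card ?D') / 2"
  have half: "real a + (real b + real b') / 2 \<le> real t" if "a + b \<le> t" "a + b' \<le> t" for a b b' t :: nat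
  proof -
    have "real (a + b) \<le> real t" "real (a + b') \<le> real t"
      using that by (simp_all only: of_nat_le_iff)
    then show ?thesis by (simp add: field_simps)
  qed
  show ?thesis
  proof (cases "c \<in> Q")
    case False
    then have Q: "Q - {c} = Q" by auto
    have mono: "U Q \<subseteq> U (insert c Q)"
      unfolding U_def by (rule reachable_mono) blast
    \<comment> \<open>Hence the heads of the edges leaving from \<open>?D\<close> and the points of
      \<open>?D'\<close> are all gained by adding \<open>c\<close>.\<close>
    have ext: "y \<in> U (insert c Q)" if "x \<in> U Q" "y \<in> H" "y = x \<otimes> c \<or> x = y \<otimes> c" for x y
      using reachable_step[of x G H v Q c y] that c Q unfolding U_def by simp
    have "card (U Q \<union> (\<lambda>x. x \<otimes> c) ` ?D) \<le> card (U (insert c Q))"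
      by (rule card_mono[OF fin]) (use mono ext in blast)
    moreover have "card (U Q \<union> ?D') \<le> card (U (insert c Q))"
      by (rule card_mono[OF fin]) (use mono ext in blast)
    moreover have "card (U Q \<union> (\<lambda>x. x \<otimes> c) ` ?D) = card (U Q) + card ?D"
    proof -
      have "card (U Q \<union> (\<lambda>x. x \<otimes> c) ` ?D) = card (U Q) + card ((\<lambda>x. x \<otimes> c) ` ?D)"
        by (rule card_Un_disjoint) (use fin finD in auto)
      moreover have "?D \<subseteq> H" using sub by blast
      ultimately show ?thesis using img by simp
    qed
    moreover have "card (U Q \<union> ?D') = card (U Q) + card ?D'"
      by (rule card_Un_disjoint) (use fin finD in auto)
    ultimately have "card (U Q) + ?m \<le> card (U (insert c Q))" by (intro half) (simp_all only:)
    then have "?m / (2 * real (card (U Q))) \<le> ln (card (U (insert c Q))) - ln (card (U Q))"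
      using pos[of Q] D D' by (intro ln_ratio_ge) auto
    then show ?thesis by (simp add: Q)
  next
    case True
    then have Q: "insert c Q = Q" by auto
    have mono: "U (Q - {c}) \<subseteq> U Q"
      unfolding U_def by (rule reachable_mono) blast
    \<comment> \<open>Hence an endpoint in \<open>U Q\<close> of a boundary edge is lost without
      \<open>c\<close>: otherwise \<open>c\<close> would be free to carry the walk to the other
      endpoint, which lies outside \<open>U Q\<close>.\<close>
    have ext: "y \<in> U Q" if "x \<in> U (Q - {c})" "y \<in> H" "y = x \<otimes> c \<or> x = y \<otimes> c" for x y
      using reachable_step[of x G H v Q c y] that c Q unfolding U_def by simp
    have "card (U (Q - {c})) \<le> card (U Q - ?D)"
      by (rule card_mono) (use fin mono ext in blast)+
    moreover have "card (U (Q - {c})) \<le> card (U Q - (\<lambda>x. x \<otimes> c) ` ?D')"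
      by (rule card_mono) (use fin mono ext in blast)+
    moreover have "card (U Q - ?D) = card (U Q) - card ?D"
      using finD by (intro card_Diff_subset) auto
    moreover have "card (U Q - (\<lambda>x. x \<otimes> c) ` ?D') = card (U Q) - card ?D'"
    proof -
      have "card (U Q - (\<lambda>x. x \<otimes> c) ` ?D') = card (U Q) - card ((\<lambda>x. x \<otimes> c) ` ?D')"
        by (rule card_Diff_subset) (use finD in auto)
      moreover have "?D' \<subseteq> H" by blast
      ultimately show ?thesis using img by simp
    qed
    ultimately have le: "card (U (Q - {c})) + ?m \<le> card (U Q)"
      using D D' by (intro half) (simp_all only: le_diff_conv2)
    have "?m / (2 * real (card (U Q))) \<le> ?m / card (U Q)"
      using pos by (intro divide_left_mono) auto
    also have "\<dots> \<le> (real (card (U Q)) - card (U (Q - {c}))) / card (U Q)"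
      using le by (intro divide_right_mono) linarith+
    also have "\<dots> = 1 - card (U (Q - {c})) / card (U Q)"
      using pos[of Q] by (simp add: diff_divide_distrib)
    also have "\<dots> \<le> ln (card (U Q)) - ln (card (U (Q - {c})))"
      using ln_le_minus_one[of "card (U (Q - {c})) / card (U Q)"] pos[of Q] pos[of "Q - {c}"]
      by (simp add: ln_div)
    finally show ?thesis by (simp add: Q)
  qed
qed

text \<open>Two subsets of an \<open>n\<close>-set that share one point have sizes \<open>a\<close>, \<open>b\<close> with \<open>a + b \<le> n + 1\<close>.\<close>

lemma double_mult_le_square:
  fixes a b n :: nat
  assumes "2 \<le> n" "a + b \<le> n + 1"
  shows "2 * (a * b) \<le> n * n"
\<comment> \<open>From 4ab \<le> (n + 1)^2 one needs (n + 1)^2 \<le> 2 n^2, which holds from n = 3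
  on; n = 2 relies on integrality.\<close>
proof (cases "n = 2")
  case True
  then have "a + b \<le> 3" using assms by simp
  then have "a = 0 \<or> a = 1 \<or> a = 2 \<or> a = 3" by arith
  then show ?thesis using True \<open>a + b \<le> 3\<close> by (elim disjE) simp_all
next
  case False
  then have n: "3 \<le> int n" using assms by simp
  have "4 * (int a * int b) \<le> (int a + int b) ^ 2"
    using zero_le_power2[of "int a - int b"] by (simp add: power2_eq_square algebra_simps)
  also have "\<dots> \<le> (int n + 1) ^ 2"
    using assms by (intro power_mono) auto
  also have "\<dots> \<le> 2 * (int n * int n)"
    using mult_mono[of 2 "int n - 1" 2 "int n - 1"] n by (simp add: power2_eq_square algebra_simps)
  finally have "2 * (int a * int b) \<le> int n * int n" by simp
  then show ?thesis by (simp flip: of_nat_mult)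
qed

text \<open>With \<open>rho\<close> the density of \<open>V\<close>, growth at rate
  \<open>rho / 4\<close> up to \<open>q = 1/2\<close> leaves a total deficit of at most
  \<open>2 * exp (- rho / 8) * ln (card V)\<close>. Dissociation forces a deficit of at least
  \<open>ln 2\<close>, and solving for \<open>rho\<close> gives the bound.\<close>

lemma (in group) dissociated_edge_bound:
  assumes diss: "dissociated G S" "finite S" and V: "finite V" "V \<subseteq> carrier G" "2 \<le> card V"
  shows "edge_count G S V \<le> 8 * (card V * ln (card V)) * ln (2 * ln (card V) / ln 2)"
proof -
  have S: "S \<subseteq> carrier G" using diss by (simp add: dissociated_def)
  define rho where "rho = edge_count G S V / (card V * ln (card V))"
  \<comment> \<open>An edge inside a set of at most one point is a loop, so its colour would be
    \<open>\<one>\<close>.\<close>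
  have small: "real (edge_count G S U) = 0" if "U \<subseteq> V" "card U \<le> 1" for U
  proof -
    have "\<not> (x \<in> U \<and> x \<otimes> c \<in> U)" if c: "c \<in> S" for x c
    proof
      assume x: "x \<in> U \<and> x \<otimes> c \<in> U"
      have "finite U" using \<open>U \<subseteq> V\<close> V finite_subset by blast
      then have "x \<otimes> c = x" using x \<open>card U \<le> 1\<close> by (auto simp: card_le_Suc0_iff_eq)
      moreover have "x \<in> carrier G" "c \<in> carrier G" using x \<open>U \<subseteq> V\<close> V S c by auto
      ultimately have "c = \<one>" by simp
      then show False using one_notin_dissociated diss c by blast
    qed
    then have empty: "{x\<in>U. x \<otimes> c \<in> U} = {}" if "c \<in> S" for c using that by blast
    show ?thesis unfolding edge_count_def by (simp add: empty)
  qed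
  obtain H where HV: "H \<subseteq> V" "2 \<le> card H" and expand: "\<And>U. U \<subseteq> H \<Longrightarrow> U \<noteq> {} \<Longrightarrow>
      rho * (card U * (ln (card H) - ln (card U)))
        \<le> real (edge_count G S H) - edge_count G S U - edge_count G S (H - U)"
    using entropy_expander[OF V(1,3), of "\<lambda>U. real (edge_count G S U)", folded rho_def] small by auto
  have H: "finite H" "H \<subseteq> carrier G" using HV V finite_subset by auto
  obtain v where v: "v \<in> H" using HV by fastforce
  let ?U = "\<lambda>Q. reachable G H v Q" and ?f = "\<lambda>Q. ln (real (card (reachable G H v Q)))"
  let ?M = "ln (real (card H))"
  have sub: "?U R \<subseteq> H" for R using reachable_subset H v by simp
  have fin: "finite (?U R)" for R using sub H finite_subset by blast
  have pos: "0 < card (?U R)" for R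
    using fin[of R] start_reachable[of v G H R] by (auto simp: card_gt_0_iff)
  \<comment> \<open>Expansion of \<open>H\<close> bounds the whole boundary of \<open>?U Q\<close>
    from below; each colour's influence is at least its boundary share over
    \<open>4 * card (?U Q)\<close>, and the cardinality cancels.\<close>
  have "rho / 4 * (?M - ?f Q) \<le> (\<Sum>c\<in>S. ?f (insert c Q) - ?f (Q - {c}))" for Q
  proof -
    let ?b = "\<lambda>c. real (card {x\<in>?U Q. x \<otimes> c \<in> H - ?U Q}) + card {x\<in>H - ?U Q. x \<otimes> c \<in> ?U Q}"
    have "rho * (card (?U Q) * (?M - ?f Q)) \<le> (\<Sum>c\<in>S. ?b c)"
      unfolding edge_count_boundary[OF H(1) sub, symmetric]
      by (rule expand[OF sub]) (use start_reachable[of v G H Q] in blast)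
    then have "rho / 4 * (?M - ?f Q) \<le> (\<Sum>c\<in>S. ?b c) / (4 * card (?U Q))"
      using pos[of Q] by (simp add: field_simps)
    also have "\<dots> \<le> (\<Sum>c\<in>S. ?f (insert c Q) - ?f (Q - {c}))"
      unfolding sum_divide_distrib
      by (intro sum_mono ln_reachable_influence) (use H v S in auto)
    finally show ?thesis .
  qed
  then obtain Q where Q: "Q \<subseteq> S"
      "2 * ?M - ?f Q - ?f (S - Q) \<le> 2 * exp (- (rho / 4) / 2) * (?M - ?f {})"
    using complementary_subsets_exist[OF diss(2), of "rho / 4" ?M ?f] by blast
  \<comment> \<open>Both sets meet only in \<open>v\<close>, so their sizes add up to at most |H| +
    1 and multiply to at most half of |H|^2.\<close>
  have "ln 2 \<le> 2 * ?M - ?f Q - ?f (S - Q)"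
  proof -
    let ?a = "card (?U Q)" and ?b = "card (?U (S - Q))" and ?n = "card H"
    have "?U Q \<inter> ?U (S - Q) = {v}"
      using reachable_Int_dissociated[OF diss(1) H(2) v] Q by auto
    then have "?a + ?b = card (?U Q \<union> ?U (S - Q)) + 1"
      using card_Un_Int[OF fin fin, of Q "S - Q"] by simp
    also have "\<dots> \<le> ?n + 1" using sub H by (simp add: card_mono)
    finally have "?a + ?b \<le> ?n + 1" .
    then have "2 * (?a * ?b) \<le> ?n * ?n"
      by (rule double_mult_le_square[OF HV(2)])
    then have "real (2 * (?a * ?b)) \<le> real (?n * ?n)"
      by (simp only: of_nat_le_iff)
    then have "2 * (real ?a * real ?b) \<le> real ?n * real ?n"
      by simp
    then have "ln (2 * (real ?a * real ?b)) \<le> ln (real ?n * real ?n)"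
      using pos[of Q] pos[of "S - Q"] by (intro ln_mono) auto
    moreover have "ln (2 * (real ?a * real ?b)) = ln 2 + (?f Q + ?f (S - Q))"
      using pos[of Q] pos[of "S - Q"] by (simp add: ln_mult_pos)
    moreover have "ln (real ?n * real ?n) = ?M + ?M"
      using HV by (intro ln_mult_pos) auto
    ultimately show ?thesis by simp
  qed
  also have "\<dots> \<le> 2 * exp (- rho / 8) * (?M - ?f {})" using Q by simp
  also have "\<dots> \<le> 2 * exp (- rho / 8) * ln (card V)"
  proof -
    have "?M \<le> ln (card V)" using HV V by (simp add: card_mono)
    moreover have "0 \<le> ?f {}" using pos[of "{}"] by simp
    ultimately show ?thesis by (intro mult_left_mono) auto
  qed
  finally have "exp (rho / 8) * ln 2 \<le> 2 * ln (card V)"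
    by (simp add: exp_minus field_simps)
  then have "exp (rho / 8) \<le> 2 * ln (card V) / ln 2"
    by (simp add: field_simps)
  then have "rho / 8 \<le> ln (2 * ln (card V) / ln 2)"
    using V by (subst ln_ge_iff) auto
  then show ?thesis
    using V by (simp add: rho_def field_simps)
qed

section \<open>The dimension bound\<close>

text \<open>For each colour in \<open>S\<close>, every point of \<open>A\<close> is the tail of an
  edge inside \<open>V\<close>.\<close>

lemma (in group) card_dissociated_mult_le_edge_count:
  assumes "finite V" "A \<subseteq> V" "A <#> S \<subseteq> V" "finite S"
  shows "card S * card A \<le> edge_count G S V"
proof -
  have "card A \<le> card {x\<in>V. x \<otimes> c \<in> V}" if "c \<in> S" for c
    by (rule card_mono) (use assms that in \<open>auto simp: set_mult_def\<close>)
  then have "(\<Sum>c\<in>S. card A) \<le> edge_count G S V"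
    unfolding edge_count_def by (intro sum_mono)
  then show ?thesis by simp
qed

text \<open>32 = 8 * 2 * 2: the constant of the edge bound, |V| \<le> 2K|A| and ln |V| \<le> 2 ln
  |A|. The quotient absorbs the summand \<open>ln (4 / ln 2)\<close> into \<open>ln (ln n)\<close>,
  which is at least \<open>ln (ln 3)\<close>.\<close>

definition dim_const :: real where
  "dim_const = 32 * (1 + ln (4 / ln 2) / ln (ln 3))"

lemma ln_3_gt_1: "1 < ln (3 :: real)"
proof -
  \<comment> \<open>At 1 the quadratic bound gives only e \<le> 3; at 1/4, followed by a fourth
    power, it is strict.\<close>
  have "exp (1/4 :: real) \<le> 1 + 1/4 + (1/4)^2" by (rule exp_bound) auto
  then have "exp (1/4 :: real) ^ 4 \<le> (21/16) ^ 4"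
    by (intro power_mono) (auto simp: power2_eq_square)
  then have "exp (1 :: real) \<le> (21/16) ^ 4" using exp_of_nat_mult[of 4 "1/4 :: real"] by simp
  also have "\<dots> < (3 :: real)" by (simp add: power4_eq_xxxx)
  finally show ?thesis using ln_less_cancel_iff[of "exp 1" "3 :: real"] by simp
qed

lemma dim_const_bound:
  assumes "3 \<le> (n :: real)"
  shows "32 * (ln (ln n) + ln (4 / ln 2)) \<le> dim_const * ln (ln n)" "1 \<le> dim_const * ln n * ln (ln n)"
proof -
  have ln3: "1 < ln (3 :: real)" by (rule ln_3_gt_1)
  have lnn: "ln 3 \<le> ln n" using assms by simp
  then have lnln: "ln (ln 3) \<le> ln (ln n)" "0 < ln (ln (3 :: real))" using ln3 by auto
  have ln2: "0 < ln (2 :: real)" "ln (2 :: real) \<le> 1" using ln_2_less_1 by auto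
  have "4 \<le> 4 / ln (2 :: real)" using ln2 by (simp add: field_simps)
  then have "ln 4 \<le> ln (4 / ln (2 :: real))" by (intro ln_mono) auto
  moreover have "ln 3 \<le> ln (4 :: real)" by simp
  ultimately have c: "1 \<le> ln (4 / ln (2 :: real))" using ln3 by linarith
  have "ln (4 / ln 2) = ln (4 / ln 2) / ln (ln 3) * ln (ln (3 :: real))" using lnln by simp
  also have "\<dots> \<le> ln (4 / ln 2) / ln (ln 3) * ln (ln n)"
    using lnln c by (intro mult_left_mono divide_nonneg_pos) linarith+
  finally have "32 * (ln (ln n) + ln (4 / ln 2)) \<le> 32 * (ln (ln n) + ln (4 / ln 2) / ln (ln 3) * ln (ln n))"
    by simp
  also have "\<dots> = dim_const * ln (ln n)"
    by (simp add: dim_const_def algebra_simps)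
  finally show 1: "32 * (ln (ln n) + ln (4 / ln 2)) \<le> dim_const * ln (ln n)" .
  have "0 \<le> ln (ln n)" using lnln by linarith
  with c have "1 \<le> 32 * (ln (ln n) + ln (4 / ln 2))" by simp
  then have "1 \<le> dim_const * ln (ln n)" using 1 by (rule order_trans)
  moreover have "1 \<le> ln n" using lnn ln3 by linarith
  ultimately have "1 * 1 \<le> ln n * (dim_const * ln (ln n))"
    by (intro mult_mono) auto
  then show "1 \<le> dim_const * ln n * ln (ln n)" by (simp add: mult_ac)
qed

lemma (in group) card_dissociated_le:
  assumes A: "A \<subseteq> carrier G" "finite A" "2 < card A" and K: "0 < K" "card (A <#> A) \<le> K * card A"
    and S: "S \<subseteq> A" "dissociated G S"
  shows "card S \<le> dim_const * K * ln (card A) * ln (ln (card A))"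
proof -
  let ?n = "real (card A)" and ?V = "A \<union> (A <#> A)"
  have n: "3 \<le> ?n" using A by simp
  have S_le: "card S \<le> card A" using S A by (simp add: card_mono)
  show ?thesis
  \<comment> \<open>If |A| \<le> K, the trivial |S| \<le> |A| suffices. Otherwise K + 1 \<le> |A|,
    so |V| \<le> |A|^2 and its logarithm does not involve \<open>K\<close>.\<close>
  proof (cases "card A \<le> K")
    case True
    have "real (card S) \<le> real K * 1" using S_le True by simp
    also have "\<dots> \<le> real K * (dim_const * ln ?n * ln (ln ?n))"
      using dim_const_bound(2)[OF n] by (intro mult_left_mono) auto
    finally show ?thesis by (simp add: mult_ac)
  next
    case False
    have finAA: "finite (A <#> A)" using A by (auto simp: set_mult_def)
    have finS: "finite S" using S A finite_subset by blast
    have V: "finite ?V" "?V \<subseteq> carrier G" using A finAA by (auto simp: set_mult_def)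
    let ?N = "real (card ?V)"
    have "card ?V \<le> (K + 1) * card A"
      using card_Un_le[of A "A <#> A"] K by simp
    then have N1: "?N \<le> (real K + 1) * ?n"
      by (metis of_nat_le_iff of_nat_mult of_nat_add of_nat_1)
    have nN: "card A \<le> card ?V" using V by (intro card_mono) auto
    have ge: "2 \<le> card ?V" using A nN by simp
    have N2: "?N \<le> 2 * real K * ?n"
      using N1 mult_right_mono[of "real K + 1" "2 * real K" ?n] K by simp
    have "(real K + 1) * ?n \<le> ?n * ?n"
      using False by (intro mult_right_mono) auto
    then have "?N \<le> ?n * ?n" using N1 by simp
    then have "ln ?N \<le> ln (?n * ?n)" using ge by (intro ln_mono) auto
    then have lnN: "ln ?N \<le> 2 * ln ?n" using n by (simp add: ln_mult_pos)
    have lnn: "1 < ln ?n"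
      using ln_3_gt_1 n by (meson less_le_trans ln_mono zero_less_numeral)
    have lnN0: "0 < ln ?N" using ge by simp
    have ln2: "0 < ln (2::real)" by simp
    have "2 * ln ?N / ln 2 \<le> ln ?n * (4 / ln 2)"
      using lnN ln2 by (simp add: field_simps)
    then have "ln (2 * ln ?N / ln 2) \<le> ln (ln ?n * (4 / ln 2))"
      using lnN0 by (intro ln_mono) auto
    also have "\<dots> = ln (ln ?n) + ln (4 / ln 2)"
      using lnn ln2 by (intro ln_mult_pos) auto
    finally have lnlnN: "ln (2 * ln ?N / ln 2) \<le> ln (ln ?n) + ln (4 / ln 2)" .
    have pos: "0 \<le> ln (ln ?n) + ln (4 / ln 2)"
    proof -
      have "ln (2::real) \<le> 4" using ln_2_less_1 by linarith
      then have "1 \<le> 4 / ln (2::real)" using ln2 by (simp add: field_simps)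
      then show ?thesis using lnn by simp
    qed
    have "A <#> S \<subseteq> ?V" using S by (auto simp: set_mult_def)
    then have "card S * card A \<le> edge_count G S ?V"
      using V finS by (intro card_dissociated_mult_le_edge_count) auto
    then have "real (card S * card A) \<le> real (edge_count G S ?V)"
      by (simp only: of_nat_le_iff)
    then have "card S * ?n \<le> edge_count G S ?V" by simp
    also have "\<dots> \<le> 8 * (?N * ln ?N) * ln (2 * ln ?N / ln 2)"
      by (rule dissociated_edge_bound) (use S finS V ge in auto)
    also have "\<dots> \<le> 8 * (?N * ln ?N) * (ln (ln ?n) + ln (4 / ln 2))"
      using lnlnN lnN0 by (intro mult_left_mono) auto
    also have "\<dots> \<le> 8 * ((2 * real K * ?n) * (2 * ln ?n)) * (ln (ln ?n) + ln (4 / ln 2))"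
      using N2 lnN lnN0 pos by (intro mult_right_mono mult_left_mono mult_mono) auto
    also have "\<dots> = (real K * ln ?n * (32 * (ln (ln ?n) + ln (4 / ln 2)))) * ?n"
      by (simp add: mult_ac)
    also have "\<dots> \<le> (real K * ln ?n * (dim_const * ln (ln ?n))) * ?n"
      using dim_const_bound(1)[OF n] lnn by (intro mult_right_mono mult_left_mono) auto
    finally have "card S \<le> real K * ln ?n * (dim_const * ln (ln ?n))"
      using n by (simp only: mult_le_cancel_right)
    then show ?thesis by (simp add: mult_ac)
  qed
qed

lemma dissociated_empty: "dissociated G {}"
  by (simp add: dissociated_iff_signed_word)

lemma add_dim_attained:
  assumes "finite A"
  obtains S where "S \<subseteq> A" "dissociated G S" "add_dim G A = card S"
proof -
  have "add_dim G A \<in> card ` {S. S \<subseteq> A \<and> dissociated G S}"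
    unfolding add_dim_def by (rule Max_in) (use assms dissociated_empty in auto)
  then show ?thesis using that by auto
qed

lemma card_le_add_dim:
  assumes "finite A" "S \<subseteq> A" "dissociated G S"
  shows "card S \<le> add_dim G A"
  unfolding add_dim_def by (rule Max_ge) (use assms in auto)

lemma (in group) dim_bound_dim_const: "dim_bound dim_const G"
  unfolding dim_bound_def
proof (intro allI impI)
  fix A :: "'a set" and K :: nat
  assume *: "A \<subseteq> carrier G \<and> finite A \<and> 2 < card A \<and> 0 < K \<and> card (A <#> A) \<le> K * card A"
  then have "finite A" by simp
  then obtain S where S: "S \<subseteq> A" "dissociated G S" "add_dim G A = card S"
    by (rule add_dim_attained)
  show "add_dim G A \<le> dim_const * K * ln (card A) * ln (ln (card A))"
    unfolding S(3) by (rule card_dissociated_le) (use * S in simp_all)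
qed

section \<open>Transfer to groups on the natural numbers\<close>

lemma (in group_hom) dissociated_vimage:
  assumes inj: "inj_on h (carrier G)" and S: "S \<subseteq> carrier G" and diss: "dissociated H (h ` S)"
  shows "dissociated G S"
  unfolding dissociated_iff_signed_word
proof (intro conjI allI impI)
  fix gs :: "'a list" and es :: "int list"
  assume *: "length es = length gs \<and> distinct gs \<and> set gs \<subseteq> S \<and> set es \<subseteq> {-1, 1} \<and>
    signed_word G gs es = \<one>\<^bsub>G\<^esub>"
  then have gs: "set gs \<subseteq> carrier G" using S by auto
  have "signed_word H (map h gs) es = \<one>\<^bsub>H\<^esub>"
    using hom_signed_word[OF gs, of es] * by simp
  moreover have "distinct (map h gs)"
    using * gs inj by (auto simp: distinct_map intro: inj_on_subset)
  moreover have "length es = length (map h gs)" "set (map h gs) \<subseteq> h ` S" using * by auto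
  ultimately have "map h gs = []"
    using diss * unfolding dissociated_iff_signed_word by blast
  then show "gs = []" by simp
qed (use S in auto)

lemma (in group_hom) hom_set_mult:
  "A \<subseteq> carrier G \<Longrightarrow> B \<subseteq> carrier G \<Longrightarrow> h ` (A <#>\<^bsub>G\<^esub> B) = h ` A <#>\<^bsub>H\<^esub> h ` B"
  by (force simp: set_mult_def image_iff)

text \<open>Generated elements are products of finite lists over \<open>A\<close> and its inverses,
  and there are countably many such lists.\<close>

lemma (in group) countable_generate:
  assumes "countable A" "A \<subseteq> carrier G"
  shows "countable (generate G A)"
proof -
  let ?T = "A \<union> (\<lambda>x. inv x) ` A"
  let ?p = "\<lambda>xs. foldr (\<otimes>) xs \<one>"
  have T: "?T \<subseteq> carrier G" using assms by auto
  have closed: "?p xs \<in> carrier G" if "set xs \<subseteq> carrier G" for xs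
    using that by (induction xs) auto
  have append: "?p (xs @ ys) = ?p xs \<otimes> ?p ys"
    if "set xs \<subseteq> carrier G" "set ys \<subseteq> carrier G" for xs ys
    using that by (induction xs) (auto simp: closed m_assoc simp del: foldr_append)
  have "x \<in> ?p ` lists ?T" if "x \<in> generate G A" for x
    using that
  proof induction
    case one
    then show ?case by (intro image_eqI[of _ _ "[]"]) auto
  next
    case (incl x)
    then show ?case using assms by (intro image_eqI[of _ _ "[x]"]) auto
  next
    case (inv x)
    then show ?case using assms by (intro image_eqI[of _ _ "[inv x]"]) auto
  next
    case (eng x y)
    then obtain xs ys where "x = ?p xs" "y = ?p ys" "xs \<in> lists ?T" "ys \<in> lists ?T" by blast
    moreover from this have "set xs \<subseteq> carrier G" "set ys \<subseteq> carrier G" using T by (auto simp: lists_eq_set)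
    ultimately show ?case
      using append[of xs ys] by (intro image_eqI[of _ _ "xs @ ys"]) (auto simp del: foldr_append)
  qed
  then have "generate G A \<subseteq> ?p ` lists ?T" by blast
  moreover have "countable (?p ` lists ?T)" using assms by simp
  ultimately show ?thesis by (rule countable_subset)
qed

lemma (in group) countable_subgroup_model:
  assumes "subgroup B G" "countable B"
  obtains N :: "nat monoid" and g where "group_hom N G g" "inj_on g (carrier N)" "g ` carrier N = B"
proof -
  let ?f = "to_nat_on B" and ?g = "from_nat_into B"
  interpret B: subgroup B G by fact
  have gf: "?g (?f x) = x" if "x \<in> B" for x using that assms(2) by simp
  \<comment> \<open>\<open>?P\<close> only carries the transported multiplication and its unit is a
    placeholder; the group is the image \<open>?N\<close>, whose unit is set to the number of
    \<open>\<one>\<close>.\<close>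
  let ?P = "\<lparr>carrier = UNIV, mult = \<lambda>i j. ?f (?g i \<otimes> ?g j), one = 0\<rparr> :: nat monoid"
  let ?N = "?P \<lparr>carrier := ?f ` carrier (G\<lparr>carrier := B\<rparr>), one := ?f \<one>\<^bsub>G\<lparr>carrier := B\<rparr>\<^esub>\<rparr>"
  have "?f \<in> hom (G\<lparr>carrier := B\<rparr>) ?P"
    by (auto simp: hom_def gf)
  then have "group ?N"
    by (rule group.hom_imp_img_group[OF B.subgroup_is_group[OF is_group]])
  moreover have "?g \<in> hom ?N G"
    by (auto simp: hom_def gf)
  ultimately have "group_hom ?N G ?g"
    by (simp add: group_hom_def group_hom_axioms_def is_group)
  moreover have "inj_on ?g (carrier ?N)"
    by (rule inj_on_inverseI[of _ ?f]) (auto simp: gf)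
  moreover have "?g ` carrier ?N = B"
    by (auto simp: gf image_image)
  ultimately show ?thesis using that by blast
qed

text \<open>The subgroup generated by \<open>A\<close> is countable, hence isomorphic to a group on
  \<open>nat\<close>. The sizes of \<open>A\<close> and its product set carry over, and a largest
  dissociated subset of \<open>A\<close> pulls back, so the same \<open>C\<close> works.\<close>

lemma (in group) dim_bound_if_nat_dim_bound:
  assumes nat: "\<And>N :: nat monoid. group N \<Longrightarrow> dim_bound C N"
  shows "dim_bound C G"
  unfolding dim_bound_def
proof (intro allI impI)
  fix A :: "'a set" and K :: nat
  assume A: "A \<subseteq> carrier G \<and> finite A \<and> 2 < card A \<and> 0 < K \<and> card (A <#> A) \<le> K * card A"
  have "subgroup (generate G A) G" using A by (intro generate_is_subgroup) auto
  moreover have "countable (generate G A)"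
    using A by (intro countable_generate) (auto intro: countable_finite)
  ultimately obtain N :: "nat monoid" and g
    where "group_hom N G g" and inj: "inj_on g (carrier N)" and img: "g ` carrier N = generate G A"
    by (rule countable_subgroup_model)
  interpret g: group_hom N G g by fact
  have "A \<subseteq> g ` carrier N" unfolding img by (auto intro: generate.incl)
  then obtain A' where A': "A' \<subseteq> carrier N" "A = g ` A'" by (auto simp: subset_image_iff)
  have card_img: "card (g ` X) = card X" if "X \<subseteq> carrier N" for X
    using inj_on_subset[OF inj that] by (rule card_image)
  have finA': "finite A'"
    using A A' inj_on_subset[OF inj A'(1)] by (simp add: finite_image_iff)
  have "A' <#>\<^bsub>N\<^esub> A' \<subseteq> carrier N" using A' by (auto simp: set_mult_def)
  then have "card (A <#> A) = card (A' <#>\<^bsub>N\<^esub> A')"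
    using g.hom_set_mult[OF A'(1) A'(1)] card_img A'(2) by metis
  moreover have card_A: "card A = card A'" using card_img[OF A'(1)] A'(2) by simp
  ultimately have "A' \<subseteq> carrier N \<and> finite A' \<and> 2 < card A' \<and> 0 < K \<and> card (A' <#>\<^bsub>N\<^esub> A') \<le> K * card A'"
    using A A'(1) finA' by simp
  then have bound: "add_dim N A' \<le> C * K * ln (card A') * ln (ln (card A'))"
    using nat[OF g.G.is_group] unfolding dim_bound_def by blast
  have "finite A" using A by simp
  then obtain S where S: "S \<subseteq> A" "dissociated G S" "add_dim G A = card S"
    by (rule add_dim_attained)
  obtain S' where S': "S' \<subseteq> A'" "S = g ` S'" using S A' by (auto simp: subset_image_iff)
  have "dissociated N S'"
    using g.dissociated_vimage[OF inj] S S' A' by auto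
  then have "card S' \<le> add_dim N A'"
    by (rule card_le_add_dim[OF finA' S'(1)])
  moreover have "card S = card S'" using card_img[of S'] S' A'(1) by auto
  ultimately have "real (add_dim G A) \<le> real (add_dim N A')" using S(3) by simp
  then show "add_dim G A \<le> C * K * ln (card A) * ln (ln (card A))"
    using bound unfolding card_A by linarith
qed

theorem theorem1p5:
  shows "(\<exists>C>0. \<forall>G :: nat monoid. group G \<longrightarrow> dim_bound C G) \<and>
    (\<forall>C>0. (\<forall>G :: nat monoid. group G \<longrightarrow> dim_bound C G) \<longrightarrow>
            (\<forall>G :: ('a, 'b) monoid_scheme. group G \<longrightarrow> dim_bound C G))"
proof (intro conjI allI impI)
  \<comment> \<open>Positivity of the constant is read off from the second bound at n = 3.\<close>
  have "0 < dim_const * (ln 3 * ln (ln 3))"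
    using dim_const_bound(2)[of 3] by (simp add: mult_ac)
  moreover have "0 < ln 3 * ln (ln (3 :: real))" using ln_3_gt_1 by simp
  ultimately have "0 < dim_const" using zero_less_mult_pos2 by blast
  then show "\<exists>C>0. \<forall>G :: nat monoid. group G \<longrightarrow> dim_bound C G"
    using group.dim_bound_dim_const by blast
next
  fix C :: real and G :: "('a, 'b) monoid_scheme"
  assume "\<forall>G :: nat monoid. group G \<longrightarrow> dim_bound C G" and "group G"
  then show "dim_bound C G" using group.dim_bound_if_nat_dim_bound by blast
qed

end
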